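(* Let $m,n$ be positive integers. For any $k\ge m$, the poset $L^k(m,n)$ is self-dual, i.e. isomorphic to its dual (opposite) poset.
   Context: Fix an integer $k\ge1$. A partition $\lambda=(\lambda_1\ge\dots\ge\lambda_\ell>0)$ is a finite (possibly empty) non-increasing sequence of positive integers, $|\lambda|=\sum_i\lambda_i$, $\ell(\lambda)$ is the number of parts, and $\lambda_i=0$ for $i>\ell(\lambda)$. Its diagram is the set of cells $(i,j)$ with $1\le j\le\lambda_i$ (row $i$, column $j$; row 1 is the lowest row, and "above" means larger row index). $\lambda\subseteq\mu$ means $\lambda_i\le\mu_i$ for all $i$. A partition is $k$-bounded if $\lambda_1\le k$; $\mathcal P^k$ is the set of $k$-bounded partitions. $(m^n)$ is the partition with $n$ parts equal to $m$. For partitions $\rho\subseteq\gamma$, the skew diagram $\gamma/\rho$ is $\{(i,j):\rho_i<j\le\gamma_i\}$; the squares of $\rho$ are said to lie below $\gamma/\rho$. For a square $(i,j)\in\gamma$ (possibly in $\rho$), its hook-length in $\gamma/\rho$ is the number of cells of $\gamma/\rho$ of the form $(i,j')$ with $j'\ge j$ or $(i',j)$ with $i'\ge i$. For $\lambda\in\mathcal P^k$, the $k$-skew diagram $\lambda/^k$ is the unique skew diagram such that (i) row $i$ has $\lambda_i$ cells, (ii) no cell of the diagram has hook-length exceeding $k$, (iii) every square below the diagram has hook-length exceeding $k$. The column lengths of $\lambda/^k$ form a $k$-bounded partition, called the $k$-conjugate $\lambda^{\omega_k}$. For $\lambda,\mu\in\mathcal P^k$ write $\lambda\prec\!\!\cdot\,\mu$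 when $\lambda\subseteq\mu$, $\lambda^{\omega_k}\subseteq\mu^{\omega_k}$ and $|\mu|-|\lambda|=1$. The partial order $\preceq$ on $\mathcal P^k$ is the reflexive-transitive closure of $\prec\!\!\cdot$; the resulting poset is $Y^k$. For $1\le m\le k$ and $n\ge1$, $L^k(m,n)=\{\mu\in\mathcal P^k:\mu\preceq(m^n)\}$ is the principal order ideal of $Y^k$ generated by $(m^n)$, ordered by $\preceq$. *)

theory Defs
  imports Main
begin

text \<open>A partition is encoded as a non-increasing, finitely supported function on the naturals:
  \<open>p i\<close> is the part with index \<open>i + 1\<close> in the usual counting, and trailing zeros are not parts.
  Rows and columns of diagrams are likewise counted from 0. Containment of partitions is the
  pointwise order \<open>\<le>\<close> on functions.\<close>

definition int_partition :: "(nat \<Rightarrow> nat) \<Rightarrow> bool" where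
  "int_partition p \<longleftrightarrow> antimono p \<and> finite {i. p i \<noteq> 0}"

definition psize :: "(nat \<Rightarrow> nat) \<Rightarrow> nat" where
  "psize p = (\<Sum>i | p i \<noteq> 0. p i)"

definition bounded_partitions :: "nat \<Rightarrow> (nat \<Rightarrow> nat) set" where
  "bounded_partitions k = {p. int_partition p \<and> p 0 \<le> k}"

definition rect :: "nat \<Rightarrow> nat \<Rightarrow> nat \<Rightarrow> nat" where
  "rect m n = (\<lambda>i. if i < n then m else 0)"

definition cells :: "(nat \<Rightarrow> nat) \<Rightarrow> (nat \<times> nat) set" where
  "cells p = {(i, j). j < p i}"

definition skew :: "(nat \<Rightarrow> nat) \<Rightarrow> (nat \<Rightarrow> nat) \<Rightarrow> (nat \<times> nat) set" where
  "skew g r = {(i, j). r i \<le> j \<and> j < g i}"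

text \<open>The square \<open>(i, j)\<close> itself need not belong to \<open>D\<close>; only cells of \<open>D\<close> are counted.\<close>

definition hook_length :: "(nat \<times> nat) set \<Rightarrow> nat \<Rightarrow> nat \<Rightarrow> nat" where
  "hook_length D i j =
     card {(i', j'). (i', j') \<in> D \<and> (i' = i \<and> j \<le> j' \<or> j' = j \<and> i \<le> i')}"

definition is_k_skew :: "nat \<Rightarrow> (nat \<Rightarrow> nat) \<Rightarrow> (nat \<Rightarrow> nat) \<Rightarrow> (nat \<Rightarrow> nat) \<Rightarrow> bool" where
  "is_k_skew k p g r \<longleftrightarrow>
     int_partition g \<and> int_partition r \<and> r \<le> g \<and>
     (\<forall>i. card {j. (i, j) \<in> skew g r} = p i) \<and>
     (\<forall>(i, j) \<in> skew g r. hook_length (skew g r) i j \<le> k) \<and>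
     (\<forall>(i, j) \<in> cells r. k < hook_length (skew g r) i j)"

text \<open>For \<open>p \<in> bounded_partitions k\<close> the diagram described here exists and is unique. Even the
  pair \<open>(g, r)\<close> is: above the last nonempty row of \<open>p\<close> every hook-length is 0, which forces
  \<open>r i = 0\<close> there.\<close>

definition k_skew :: "nat \<Rightarrow> (nat \<Rightarrow> nat) \<Rightarrow> (nat \<times> nat) set" where
  "k_skew k p = (THE D. \<exists>g r. is_k_skew k p g r \<and> D = skew g r)"

definition k_conjugate :: "nat \<Rightarrow> (nat \<Rightarrow> nat) \<Rightarrow> (nat \<Rightarrow> nat)" where
  "k_conjugate k p = (\<lambda>j. card {i. (i, j) \<in> k_skew k p})"

definition weak_cover :: "nat \<Rightarrow> (nat \<Rightarrow> nat) \<Rightarrow> (nat \<Rightarrow> nat) \<Rightarrow> bool" where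
  "weak_cover k p q \<longleftrightarrow>
     p \<in> bounded_partitions k \<and> q \<in> bounded_partitions k \<and>
     p \<le> q \<and> k_conjugate k p \<le> k_conjugate k q \<and> psize q = psize p + 1"

definition weak_le :: "nat \<Rightarrow> (nat \<Rightarrow> nat) \<Rightarrow> (nat \<Rightarrow> nat) \<Rightarrow> bool" where
  "weak_le k = (weak_cover k)\<^sup>*\<^sup>*"

definition order_ideal :: "nat \<Rightarrow> nat \<Rightarrow> nat \<Rightarrow> (nat \<Rightarrow> nat) set" where
  "order_ideal k m n = {p \<in> bounded_partitions k. weak_le k p (rect m n)}"

definition order_isomorphic ::
  "'a set \<Rightarrow> ('a \<Rightarrow> 'a \<Rightarrow> bool) \<Rightarrow> 'b set \<Rightarrow> ('b \<Rightarrow> 'b \<Rightarrow> bool) \<Rightarrow> bool" where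
  "order_isomorphic A leA B leB \<longleftrightarrow>
     (\<exists>f. bij_betw f A B \<and> (\<forall>x\<in>A. \<forall>y\<in>A. leA x y \<longleftrightarrow> leB (f x) (f y)))"

definition self_dual :: "'a set \<Rightarrow> ('a \<Rightarrow> 'a \<Rightarrow> bool) \<Rightarrow> bool" where
  "self_dual A le \<longleftrightarrow> order_isomorphic A le A (\<lambda>x y. le y x)"

end

theory Submission
  imports Defs
begin

text \<open>
  Put \<open>r = k - m + 1\<close> and call a part of a partition short if it is positive but smaller than \<open>m\<close>.
  The order ideal generated by the rectangle \<open>(m\<^sup>n)\<close> consists of the partitions inside the rectangle
  with at most \<open>r\<close> short parts, and on this set the order is plain containment of diagrams
  (\<open>order_ideal_eq\<close>, \<open>weak_le_imp_le\<close>, \<open>weak_le_if_le\<close>). Complementation in the rectangle turns short parts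
  into short parts and reverses containment, so it is the required duality.

  The description of the ideal rests on the \<open>k\<close>-skew diagram being a greedy packing
  (\<open>is_k_skew_iff_packed\<close>): going from the top row down, each row is placed as far to the left as
  its hook-length bound permits, so its shift is the first column \<open>c\<close> for which its length plus
  the number of cells above it in column \<open>c\<close> is at most \<open>k\<close>. In particular the diagram exists and
  is unique.

  Let \<open>p\<close> have parts at most \<open>m\<close> and at most \<open>r\<close> short ones. The short rows lie on top and need no
  shift. A row of length \<open>m\<close> may start at a column exactly if fewer than \<open>r\<close> cells lie above it
  there, and it meets every residue class of columns modulo \<open>m\<close> once. So the columns of one residue
  class are filled one after the other, each up to height \<open>r\<close>, and column \<open>j + m t\<close> with \<open>j < m\<close>
  receives \<open>min r (p'\<^sub>j - r t)\<close> cells, where \<open>p'\<^sub>j\<close> is the length of column \<open>j\<close> of the ordinary diagram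
  and the subtraction is truncated (\<open>k_conjugate_few_short\<close>). This is monotone in \<open>p\<close>, so between such
  partitions containment implies containment of the \<open>k\<close>-conjugates. If \<open>p\<close> has more than \<open>r\<close> short
  parts, then the first \<open>r + 1\<close> rows from the top are all unshifted and the first column of the
  \<open>k\<close>-skew diagram is longer than \<open>r\<close> (\<open>k_conjugate_many_short\<close>); such a \<open>p\<close> is covered by no
  partition in the rectangle with at most \<open>r\<close> short parts, and hence lies outside the ideal.
\<close>

section \<open>Row shifts and column heights\<close>

text \<open>A skew diagram is encoded by its row lengths \<open>p\<close> and row shifts \<open>s\<close>: row \<open>i\<close> occupies the columns
  from \<open>s i\<close> to \<open>s i + p i - 1\<close>. Only rows from \<open>i\<close> upwards are counted, because the packing
  proceeds downwards; the zero shift gives the column lengths of the ordinary diagram.\<close>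

definition col_height :: "(nat \<Rightarrow> nat) \<Rightarrow> (nat \<Rightarrow> nat) \<Rightarrow> nat \<Rightarrow> nat \<Rightarrow> nat" where
  "col_height p s i c = card {i'. i \<le> i' \<and> s i' \<le> c \<and> c < s i' + p i'}"

text \<open>The condition on \<open>s i\<close> says that row \<open>i\<close> is pushed left until the hook of its first cell would
  exceed \<open>k\<close>.\<close>

definition packed :: "nat \<Rightarrow> (nat \<Rightarrow> nat) \<Rightarrow> (nat \<Rightarrow> nat) \<Rightarrow> bool" where
  "packed k p s \<longleftrightarrow> (\<forall>i. s i = (LEAST c. p i + col_height p s (Suc i) c \<le> k))"

lemma finite_support_bound:
  fixes p :: "nat \<Rightarrow> nat"
  assumes "finite {i. p i \<noteq> 0}"
  shows "\<exists>N. \<forall>i\<ge>N. p i = 0"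
proof -
  obtain N where N: "\<forall>i\<in>{i. p i \<noteq> 0}. i < N"
    using finite_nat_set_iff_bounded[THEN iffD1, OF assms] ..
  have "p i = 0" if "N \<le> i" for i
    using bspec[OF N, of i] that by (metis leD mem_Collect_eq)
  then show ?thesis by (intro exI allI impI)
qed

lemma finite_column:
  fixes p :: "nat \<Rightarrow> nat"
  assumes "finite {i. p i \<noteq> 0}"
  shows "finite {i'. i \<le> i' \<and> s i' \<le> c \<and> c < s i' + p i'}"
  by (rule finite_subset[OF _ assms]) auto

lemma col_height_Suc:
  assumes "finite {i. p i \<noteq> 0}"
  shows "col_height p s i c =
    col_height p s (Suc i) c + (if s i \<le> c \<and> c < s i + p i then 1 else 0)"
proof -
  let ?A = "\<lambda>i. {i'. i \<le> i' \<and> s i' \<le> c \<and> c < s i' + p i'}"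
  have "?A i = (if s i \<le> c \<and> c < s i + p i then insert i (?A (Suc i)) else ?A (Suc i))"
    by (auto simp: Suc_le_eq le_less)
  moreover have "i \<notin> ?A (Suc i)" by simp
  ultimately show ?thesis
    using finite_column[OF assms] by (simp add: col_height_def)
qed

lemma col_height_eq_0:
  assumes "\<And>i'. i \<le> i' \<Longrightarrow> p i' = 0"
  shows "col_height p s i c = 0"
proof -
  have "{i'. i \<le> i' \<and> s i' \<le> c \<and> c < s i' + p i'} = {}"
    using assms by fastforce
  then show ?thesis unfolding col_height_def by (metis card.empty)
qed

lemma col_height_le_length:
  assumes "finite {i. p i \<noteq> 0}"
  shows "col_height p s i c \<le> col_height p (\<lambda>_. 0) i 0"
  unfolding col_height_def
  by (rule card_mono) (use finite_column[OF assms, of i "\<lambda>_. 0" 0] in auto)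

lemma col_height_antimono_rows:
  assumes "finite {i. p i \<noteq> 0}" and "i \<le> i'"
  shows "col_height p s i' c \<le> col_height p s i c"
  unfolding col_height_def
  by (rule card_mono[OF finite_column[OF assms(1)]]) (use assms(2) in auto)

section \<open>Diagrams as greedy packings\<close>

text \<open>Beyond all rows of the diagram the columns are empty, so the minimum that defines a shift is
  attained as soon as no row is longer than \<open>k\<close>.\<close>

lemma packed_shift:
  assumes "packed k p s" and "finite {i. p i \<noteq> 0}" and "\<And>i. p i \<le> k"
  shows "p i + col_height p s (Suc i) (s i) \<le> k"
    and "c < s i \<Longrightarrow> k < p i + col_height p s (Suc i) c"
proof -
  obtain N where N: "\<And>i. N \<le> i \<Longrightarrow> p i = 0"
    using finite_support_bound[OF assms(2)] by metis
  have "s i' + p i' \<le> (\<Sum>i<N. s i + p i)" if "p i' \<noteq> 0" for i'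
  proof -
    have "i' < N" using N[of i'] that by (metis not_le)
    then show ?thesis
      using member_le_sum[of i' "{..<N}" "\<lambda>i. s i + p i"] by simp
  qed
  then obtain b where b: "\<And>i'. p i' \<noteq> 0 \<Longrightarrow> s i' + p i' \<le> b" by metis
  have "{i'. Suc i \<le> i' \<and> s i' \<le> b \<and> b < s i' + p i'} = {}"
    using b by (metis (mono_tags, lifting) Collect_empty_eq add_0_right leD)
  then have "col_height p s (Suc i) b = 0"
    unfolding col_height_def by (metis card.empty)
  then have ex: "p i + col_height p s (Suc i) b \<le> k"
    using assms(3) by simp
  have eq: "s i = (LEAST c. p i + col_height p s (Suc i) c \<le> k)"
    using assms(1) unfolding packed_def by blast
  show "p i + col_height p s (Suc i) (s i) \<le> k"
    unfolding eq by (rule LeastI[where P = "\<lambda>c. p i + col_height p s (Suc i) c \<le> k", OF ex])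
  show "k < p i + col_height p s (Suc i) c" if "c < s i"
    using not_less_Least[of c "\<lambda>c. p i + col_height p s (Suc i) c \<le> k"] that eq by simp
qed

text \<open>A shift only involves the rows above it, so a packing can be built by adding rows at the bottom.
  Removing the lowest row renumbers the others, hence the induction on the number of rows.\<close>

lemma packed_exists:
  assumes "\<forall>i\<ge>N. p i = 0"
  shows "\<exists>s. packed k p s"
  using assms
proof (induction N arbitrary: p)
  case 0
  then have "packed k p (\<lambda>_. 0)"
    by (simp add: packed_def col_height_eq_0)
  then show ?case by (rule exI[where x = "\<lambda>_. 0"])
next
  case (Suc N)
  let ?q = "\<lambda>i. p (Suc i)"
  have "\<exists>s. packed k ?q s" by (rule Suc.IH) (simp add: Suc.prems)
  then obtain s where s: "packed k ?q s" ..
  let ?s = "case_nat (LEAST c. p 0 + col_height ?q s 0 c \<le> k) s"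
  have shift: "col_height p ?s (Suc i) c = col_height ?q s i c" for i c
  proof -
    have eq: "{i'. Suc i \<le> i' \<and> ?s i' \<le> c \<and> c < ?s i' + p i'} =
        Suc ` {i'. i \<le> i' \<and> s i' \<le> c \<and> c < s i' + ?q i'}" (is "?A = Suc ` ?B")
    proof (intro set_eqI iffI)
      fix x assume "x \<in> ?A"
      then show "x \<in> Suc ` ?B" by (cases x) auto
    qed auto
    show ?thesis unfolding col_height_def[of p ?s] col_height_def[of ?q s i c] eq
      by (rule card_image) simp
  qed
  have "?s i = (LEAST c. p i + col_height p ?s (Suc i) c \<le> k)" for i
  proof (cases i)
    case 0
    then show ?thesis by (simp add: shift)
  next
    case (Suc j)
    have "s j = (LEAST c. ?q j + col_height ?q s (Suc j) c \<le> k)"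
      using s unfolding packed_def by (rule spec)
    then show ?thesis unfolding shift Suc by simp
  qed
  then have "packed k p ?s" unfolding packed_def by (rule allI)
  then show ?case by (rule exI[where x = ?s])
qed

lemma packed_unique:
  assumes "packed k p s" and "packed k p s'" and "finite {i. p i \<noteq> 0}"
  shows "s = s'"
proof -
  obtain N where N: "\<And>i. N \<le> i \<Longrightarrow> p i = 0"
    using finite_support_bound[OF assms(3)] by metis
  have "s i = s' i" for i
  proof (induction "N - i" arbitrary: i rule: less_induct)
    case less
    have "(Suc i \<le> i' \<and> s i' \<le> c \<and> c < s i' + p i') =
        (Suc i \<le> i' \<and> s' i' \<le> c \<and> c < s' i' + p i')" for i' c
    proof (cases "Suc i \<le> i' \<and> i' < N")
      case True
      then have "N - i' < N - i" by linarith
      then show ?thesis using less by simp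
    next
      case False
      then have "\<not> Suc i \<le> i' \<or> p i' = 0" using N not_less by blast
      then show ?thesis by auto
    qed
    then have "col_height p s (Suc i) = col_height p s' (Suc i)"
      unfolding col_height_def by presburger
    then show ?case using assms(1,2) unfolding packed_def by metis
  qed
  then show ?thesis by blast
qed

text \<open>The column part of the hook is counted strictly above row \<open>i\<close>, since the cell \<open>(i, j)\<close>, if present,
  belongs to the row part; \<open>max\<close> accounts for squares below the diagram, whose hook contains the
  whole row.\<close>

lemma hook_length_skew:
  assumes "finite {i. p i \<noteq> 0}"
  shows "hook_length (skew (\<lambda>i. s i + p i) s) i j =
    (s i + p i - max j (s i)) + col_height p s (Suc i) j"
proof -
  let ?C = "{i'. Suc i \<le> i' \<and> s i' \<le> j \<and> j < s i' + p i'}"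
  let ?R = "{max j (s i)..<s i + p i}"
  have "{(i', j'). (i', j') \<in> skew (\<lambda>i. s i + p i) s \<and> (i' = i \<and> j \<le> j' \<or> j' = j \<and> i \<le> i')}
      = Pair i ` ?R \<union> (\<lambda>i'. (i', j)) ` ?C"
    by (rule set_eqI) (auto simp: skew_def image_iff Suc_le_eq order.order_iff_strict)
  then have "hook_length (skew (\<lambda>i. s i + p i) s) i j = card (Pair i ` ?R \<union> (\<lambda>i'. (i', j)) ` ?C)"
    unfolding hook_length_def by presburger
  also have "\<dots> = card (Pair i ` ?R) + card ((\<lambda>i'. (i', j)) ` ?C)"
    by (rule card_Un_disjoint) (use finite_column[OF assms] in auto)
  also have "\<dots> = card ?R + card ?C"
    by (simp add: card_image inj_on_def)
  finally show ?thesis by (simp add: col_height_def)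
qed

text \<open>Given the cells above, the hook-length conditions at the first cell of a row and at the squares
  to its left say exactly that its shift is minimal. Conversely, minimality gives the bounds at the
  other cells of the row as well: the shifts decrease upwards, so a row above that reaches a column
  \<open>j \<ge> s i\<close> also covers column \<open>s i\<close>, and hook-lengths decrease along the row.\<close>

lemma is_k_skew_iff_packed:
  assumes "p \<in> bounded_partitions k"
  shows "is_k_skew k p g s \<longleftrightarrow> packed k p s \<and> g = (\<lambda>i. s i + p i)"
proof -
  have anti: "antimono p" and fin: "finite {i. p i \<noteq> 0}" and "p 0 \<le> k"
    using assms by (auto simp: bounded_partitions_def int_partition_def)
  then have bound: "p i \<le> k" for i
    using antimonoD[OF anti, of 0 i] by simp
  obtain N where N: "\<And>i. N \<le> i \<Longrightarrow> p i = 0"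
    using finite_support_bound[OF fin] by metis
  show ?thesis
  proof
    assume skew: "is_k_skew k p g s"
    have "p i = g i - s i" for i
    proof -
      have "{j. (i, j) \<in> skew g s} = {s i..<g i}" by (auto simp: skew_def)
      then show ?thesis using skew unfolding is_k_skew_def by (metis card_atLeastLessThan)
    qed
    moreover have "s i \<le> g i" for i
      using skew by (simp add: is_k_skew_def le_fun_def)
    ultimately have g: "g = (\<lambda>i. s i + p i)" by auto
    note hook = hook_length_skew[OF fin, of s]
    have below: "k < p i + col_height p s (Suc i) c" if "c < s i" for i c
    proof -
      have "(i, c) \<in> cells s" using that by (simp add: cells_def)
      then have "k < hook_length (skew g s) i c"
        using skew unfolding is_k_skew_def by fast
      then show ?thesis using that by (simp add: g hook)
    qed
    have "s i = (LEAST c. p i + col_height p s (Suc i) c \<le> k)" for i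
    proof (rule Least_equality[symmetric])
      show "p i + col_height p s (Suc i) (s i) \<le> k"
      proof (cases "p i = 0")
        case True
        \<comment> \<open>An empty row has no first cell, but then nothing lies above it either.\<close>
        then have "p i' = 0" if "i \<le> i'" for i'
          using antimonoD[OF anti that] by simp
        then show ?thesis using True by (simp add: col_height_eq_0)
      next
        case False
        then have "(i, s i) \<in> skew g s" by (simp add: skew_def g)
        then have "hook_length (skew g s) i (s i) \<le> k"
          using skew unfolding is_k_skew_def by fast
        then show ?thesis by (simp add: g hook)
      qed
    next
      show "s i \<le> c" if "p i + col_height p s (Suc i) c \<le> k" for c
        using below[of c i] that by linarith
    qed
    then show "packed k p s \<and> g = (\<lambda>i. s i + p i)" using g by (simp add: packed_def)
  next
    assume "packed k p s \<and> g = (\<lambda>i. s i + p i)"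
    then have packed: "packed k p s" and g: "g = (\<lambda>i. s i + p i)" by auto
    note shift = packed_shift[OF packed fin bound]
    \<comment> \<open>A column too full for the shorter row above is too full for the longer row below it.\<close>
    have "s (Suc i) \<le> s i" for i
    proof (rule ccontr)
      assume "\<not> s (Suc i) \<le> s i"
      then have "k < p (Suc i) + col_height p s (Suc (Suc i)) (s i)"
        by (intro shift) simp
      also have "\<dots> \<le> p i + col_height p s (Suc i) (s i)"
        using antimonoD[OF anti, of i "Suc i"] col_height_antimono_rows[OF fin, of "Suc i" "Suc (Suc i)"]
        by (simp add: add_mono)
      finally show False using shift(1)[of i] by simp
    qed
    then have anti_s: "antimono s" by (simp add: antimono_iff_le_Suc)
    have s0: "s i = 0" if "N \<le> i" for i
    proof -
      have "col_height p s (Suc i) 0 = 0"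
        by (rule col_height_eq_0) (use N that in simp)
      then have "\<not> k < p i + col_height p s (Suc i) 0" using bound[of i] by simp
      then show ?thesis using shift(2) by blast
    qed
    have "i < N" if "s i \<noteq> 0 \<or> p i \<noteq> 0" for i
      using s0[of i] N[of i] that by (meson not_le)
    then have "{i. s i \<noteq> 0} \<subseteq> {..<N}" and "{i. g i \<noteq> 0} \<subseteq> {..<N}"
      by (auto simp: g)
    then have "finite {i. s i \<noteq> 0}" "finite {i. g i \<noteq> 0}"
      using finite_subset by blast+
    moreover have "antimono g"
      using antimonoD[OF anti_s] antimonoD[OF anti] by (auto simp: g antimono_def intro: add_mono)
    moreover have "card {j. (i, j) \<in> skew g s} = p i" for i
    proof -
      have "{j. (i, j) \<in> skew g s} = {s i..<g i}" by (auto simp: skew_def)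
      then show ?thesis by (simp add: g)
    qed
    moreover have "hook_length (skew g s) i j \<le> k" if "(i, j) \<in> skew g s" for i j
    proof -
      have j: "s i \<le> j" "j < s i + p i" using that by (auto simp: skew_def g)
      have "col_height p s (Suc i) j \<le> col_height p s (Suc i) (s i)"
        unfolding col_height_def
      proof (rule card_mono[OF finite_column[OF fin]], safe)
        fix i' assume "Suc i \<le> i'" "j < s i' + p i'"
        then show "s i' \<le> s i" "s i < s i' + p i'"
          using antimonoD[OF anti_s, of i i'] j by auto
      qed
      then show ?thesis using j shift(1)[of i] by (simp add: g hook_length_skew[OF fin])
    qed
    moreover have "k < hook_length (skew g s) i j" if "(i, j) \<in> cells s" for i j
      using that shift(2)[of j i] by (simp add: g hook_length_skew[OF fin] cells_def)
    ultimately show "is_k_skew k p g s"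
      using anti_s by (auto simp: is_k_skew_def int_partition_def g le_fun_def)
  qed
qed

lemma k_conjugate_packed:
  assumes "p \<in> bounded_partitions k" and "packed k p s"
  shows "k_conjugate k p c = col_height p s 0 c"
proof -
  have fin: "finite {i. p i \<noteq> 0}"
    using assms by (auto simp: bounded_partitions_def int_partition_def)
  have "k_skew k p = skew (\<lambda>i. s i + p i) s"
    unfolding k_skew_def is_k_skew_iff_packed[OF assms(1)]
    by (rule the_equality) (use assms(2) packed_unique[OF _ _ fin] in blast)+
  then show ?thesis by (simp add: k_conjugate_def col_height_def skew_def)
qed

lemma ex_packed:
  assumes "p \<in> bounded_partitions k"
  shows "\<exists>s. packed k p s"
proof -
  have fin: "finite {i. p i \<noteq> 0}"
    using assms by (auto simp: bounded_partitions_def int_partition_def)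
  obtain N where "\<forall>i\<ge>N. p i = 0"
    using finite_support_bound[OF fin] ..
  then show ?thesis by (rule packed_exists)
qed

section \<open>The conjugate of a partition with few short parts\<close>

definition short_rows :: "nat \<Rightarrow> (nat \<Rightarrow> nat) \<Rightarrow> nat set" where
  "short_rows m p = {i. 0 < p i \<and> p i < m}"

lemma finite_short_rows:
  assumes "finite {i. p i \<noteq> 0}"
  shows "finite (short_rows m p)"
  by (rule finite_subset[OF _ assms]) (auto simp: short_rows_def)

lemma col_height_unshifted_antimono:
  assumes "finite {i. p i \<noteq> 0}" and "j \<le> j'"
  shows "col_height p (\<lambda>_. 0) i j' \<le> col_height p (\<lambda>_. 0) i j"
  unfolding col_height_def
  by (rule card_mono[OF finite_column[OF assms(1)]]) (use assms(2) in auto)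

text \<open>Columns of the ordinary diagram within width \<open>m\<close> differ in length only by short rows. With at most \<open>r\<close>
  of them, filling the columns of all residue classes modulo \<open>m\<close> in steps of \<open>r\<close> keeps them at most one
  step apart.\<close>

lemma length_le_full_plus_short:
  assumes "finite {i. p i \<noteq> 0}"
  shows "col_height p (\<lambda>_. 0) i 0 \<le> col_height p (\<lambda>_. 0) i (m - 1) + card (short_rows m p)"
proof -
  let ?A = "\<lambda>j. {i'. i \<le> i' \<and> 0 \<le> j \<and> j < 0 + p i'}"
  have "?A 0 \<subseteq> ?A (m - 1) \<union> short_rows m p"
    by (auto simp: short_rows_def)
  then have "card (?A 0) \<le> card (?A (m - 1) \<union> short_rows m p)"
    using finite_column[OF assms, of i "\<lambda>_. 0" "m - 1"] finite_short_rows[OF assms, of m]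
    by (intro card_mono) auto
  also have "\<dots> \<le> card (?A (m - 1)) + card (short_rows m p)"
    by (rule card_Un_le)
  finally show ?thesis by (simp add: col_height_def)
qed

text \<open>Induction from the top row down. Short rows stay unshifted because \<open>(m - 1) + (r - 1) < k\<close>. A row of
  length \<open>m\<close> covers the first \<open>m\<close> columns starting with the first one that holds fewer than \<open>r\<close> cells;
  since the full columns form an initial segment, these are the columns \<open>c\<close> that are not full while
  \<open>c - m\<close> is full (or \<open>c < m\<close>), which is one column in each residue class.\<close>

lemma packed_col_height_eq:
  assumes p: "p \<in> bounded_partitions m" and "1 \<le> m" and k: "k + 1 = m + r" and "1 \<le> r"
    and short: "card (short_rows m p) \<le> r" and packed: "packed k p s"
  shows "col_height p s i c = min r (col_height p (\<lambda>_. 0) i (c mod m) - r * (c div m))"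
proof -
  have anti: "antimono p" and fin: "finite {i. p i \<noteq> 0}" and "p 0 \<le> m"
    using p by (auto simp: bounded_partitions_def int_partition_def)
  then have pm: "p i \<le> m" for i
    using antimonoD[OF anti, of 0 i] by simp
  have "p i \<le> k" for i using pm[of i] k \<open>1 \<le> r\<close> by linarith
  note shift = packed_shift[OF packed fin this]
  let ?P = "col_height p (\<lambda>_. 0)"
  obtain N where N: "\<And>i. N \<le> i \<Longrightarrow> p i = 0"
    using finite_support_bound[OF fin] by metis
  show ?thesis
  proof (induction "N - i" arbitrary: i c)
    case 0
    then show ?case by (simp add: col_height_eq_0 N)
  next
    case (Suc d)
    then have "d = N - Suc i" by simp
    note IH = Suc.hyps(1)[OF this]
    have P_Suc: "?P i j = ?P (Suc i) j + (if j < p i then 1 else 0)" for j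
      using col_height_Suc[OF fin, of "\<lambda>_. 0" i j] by simp
    have m0: "0 < m" using \<open>1 \<le> m\<close> by simp
    show ?case
    proof (cases "p i = m")
      case False
      then have lt: "p i < m" using pm[of i] by simp
      have Pr: "?P i j \<le> r" for j
      proof -
        have "{i'. i \<le> i' \<and> 0 \<le> j \<and> j < 0 + p i'} \<subseteq> short_rows m p"
          using antimonoD[OF anti, of i] lt by (fastforce simp: short_rows_def)
        then have "?P i j \<le> card (short_rows m p)"
          unfolding col_height_def by (rule card_mono[OF finite_short_rows[OF fin]])
        then show ?thesis using short by simp
      qed
      have "p i + col_height p s (Suc i) 0 \<le> k"
      proof (cases "p i = 0")
        case True
        then have "p i' = 0" if "i \<le> i'" for i'
          using antimonoD[OF anti that] by simp
        then show ?thesis using True by (simp add: col_height_eq_0)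
      next
        case False
        then have "?P (Suc i) 0 + 1 \<le> r" using Pr[of 0] P_Suc[of 0] by simp
        moreover have "col_height p s (Suc i) 0 \<le> ?P (Suc i) 0"
          by (rule col_height_le_length[OF fin])
        ultimately show ?thesis using lt k by linarith
      qed
      then have "s i = 0" using shift(2)[of 0 i] by linarith
      then have step: "col_height p s i c = col_height p s (Suc i) c + (if c < p i then 1 else 0)"
        using col_height_Suc[OF fin, of s i c] by simp
      show ?thesis
      proof (cases "c < m")
        case True
        then show ?thesis using step IH[of c] P_Suc[of c] Pr[of c] by auto
      next
        case False
        then have "1 \<le> c div m" using m0 by (simp add: div_greater_zero_iff Suc_le_eq)
        then have "r \<le> r * (c div m)" using \<open>1 \<le> r\<close> by simp
        moreover have "?P (Suc i) (c mod m) \<le> r" using Pr[of "c mod m"] P_Suc[of "c mod m"] by simp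
        ultimately have "?P (Suc i) (c mod m) - r * (c div m) = 0"
          and "?P i (c mod m) - r * (c div m) = 0"
          using Pr[of "c mod m"] by linarith+
        then show ?thesis using step IH[of c] lt False by simp
      qed
    next
      case True
      \<comment> \<open>By the induction hypothesis this says that column \<open>c\<close> already holds \<open>r\<close> cells.\<close>
      define full where "full c \<longleftrightarrow> r * (c div m + 1) \<le> ?P (Suc i) (c mod m)" for c
      have full_iff: "full c \<longleftrightarrow> k < p i + col_height p s (Suc i) c" for c
        using IH[of c] k \<open>1 \<le> r\<close> True by (auto simp: full_def min_def)
      \<comment> \<open>If \<open>c\<close> and \<open>c'\<close> lie in different blocks of \<open>m\<close> columns, the spare \<open>r\<close> from the earlier block
        outweighs the difference between the lengths of any two of the first \<open>m\<close> columns.\<close>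
      have full_down: "full c" if "full c'" "c \<le> c'" for c c'
      proof (cases "c div m = c' div m")
        case True
        then have "c mod m \<le> c' mod m"
          using that(2) by (metis add_le_cancel_left mult_div_mod_eq)
        then show ?thesis
          using that(1) True col_height_unshifted_antimono[OF fin, of "c mod m" "c' mod m" "Suc i"]
          by (simp add: full_def)
      next
        case False
        then have "c div m + 1 \<le> c' div m" using div_le_mono[OF that(2), of m] by simp
        then have "r * (c div m + 1 + 1) \<le> r * (c' div m + 1)" by (intro mult_le_mono) auto
        also have "\<dots> \<le> ?P (Suc i) (c' mod m)" using that(1) by (simp add: full_def)
        also have "\<dots> \<le> ?P (Suc i) 0" by (rule col_height_unshifted_antimono[OF fin]) simp
        also have "\<dots> \<le> ?P (Suc i) (m - 1) + r"
          using length_le_full_plus_short[OF fin, of "Suc i" m] short by linarith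
        also have "\<dots> \<le> ?P (Suc i) (c mod m) + r"
          using col_height_unshifted_antimono[OF fin, of "c mod m" "m - 1" "Suc i"]
            mod_less_divisor[OF m0, of c] by simp
        finally show ?thesis by (simp add: full_def)
      qed
      have full_less: "full c \<longleftrightarrow> c < s i" for c
        using shift(1)[of i] shift(2)[of c i] full_down[of c "s i"] full_iff[of c] full_iff[of "s i"]
        by (meson not_le)
      have prev: "c < s i + m \<longleftrightarrow> r * (c div m) \<le> ?P (Suc i) (c mod m)"
      proof (cases "c < m")
        case True
        then show ?thesis by simp
      next
        case False
        then obtain b where "c = b + m" using le_Suc_ex by (metis add.commute not_le)
        moreover have "(b + m) div m = b div m + 1" using m0 by (intro div_add_self2) simp
        ultimately show ?thesis using full_less[of b] by (simp add: full_def)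
      qed
      have "col_height p s i c = col_height p s (Suc i) c +
          (if r * (c div m) \<le> ?P (Suc i) (c mod m) \<and> ?P (Suc i) (c mod m) < r * (c div m + 1)
           then 1 else 0)"
        using col_height_Suc[OF fin, of s i c] full_less[of c] prev True
        by (auto simp: full_def)
      then show ?thesis using IH[of c] P_Suc[of "c mod m"] True mod_less_divisor[OF m0, of c]
        by (auto simp: min_def algebra_simps)
    qed
  qed
qed

lemma bounded_partitions_mono:
  assumes "p \<in> bounded_partitions m" and "m \<le> k"
  shows "p \<in> bounded_partitions k"
  using assms by (auto simp: bounded_partitions_def)

lemma k_conjugate_few_short:
  assumes p: "p \<in> bounded_partitions m" and m: "1 \<le> m" "m \<le> k"
    and short: "card (short_rows m p) \<le> k - m + 1"
  shows "k_conjugate k p c = min (k - m + 1) (card {i. c mod m < p i} - (k - m + 1) * (c div m))"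
proof -
  have pk: "p \<in> bounded_partitions k" using bounded_partitions_mono[OF p m(2)] .
  obtain s where s: "packed k p s" using ex_packed[OF pk] ..
  have "col_height p s 0 c =
      min (k - m + 1) (col_height p (\<lambda>_. 0) 0 (c mod m) - (k - m + 1) * (c div m))"
    using m by (intro packed_col_height_eq[OF p m(1) _ _ short s]) auto
  then show ?thesis by (simp add: k_conjugate_packed[OF pk s] col_height_def)
qed

lemma k_conjugate_mono:
  assumes "p \<in> bounded_partitions m" "q \<in> bounded_partitions m" and "1 \<le> m" "m \<le> k"
    and "card (short_rows m p) \<le> k - m + 1" "card (short_rows m q) \<le> k - m + 1" and "p \<le> q"
  shows "k_conjugate k p \<le> k_conjugate k q"
proof (rule le_funI)
  fix c
  have "finite {i. q i \<noteq> 0}"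
    using assms(2) by (simp add: bounded_partitions_def int_partition_def)
  then have "finite {i. c mod m < q i}" by (rule rev_finite_subset) auto
  moreover have "{i. c mod m < p i} \<subseteq> {i. c mod m < q i}"
    using assms(7) by (auto simp: le_fun_def intro: less_le_trans)
  ultimately have "card {i. c mod m < p i} \<le> card {i. c mod m < q i}"
    by (rule card_mono)
  then have "min (k - m + 1) (card {i. c mod m < p i} - (k - m + 1) * (c div m))
      \<le> min (k - m + 1) (card {i. c mod m < q i} - (k - m + 1) * (c div m))"
    by (intro min.mono diff_le_mono) simp_all
  then show "k_conjugate k p c \<le> k_conjugate k q c"
    using assms by (simp only: k_conjugate_few_short)
qed

text \<open>As long as at most \<open>r = k - m + 1\<close> nonempty rows lie above, a short row fits unshifted, because
  \<open>(m - 1) + r = k\<close>. With more than \<open>r\<close> short rows this applies to the first \<open>r + 1\<close> rows from the top.\<close>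

lemma k_conjugate_many_short:
  assumes p: "p \<in> bounded_partitions m" and "m \<le> k"
    and short: "k - m + 1 < card (short_rows m p)"
  shows "k - m + 1 < k_conjugate k p 0"
proof -
  have anti: "antimono p" and fin: "finite {i. p i \<noteq> 0}" and "p 0 \<le> m"
    using p by (auto simp: bounded_partitions_def int_partition_def)
  have pk: "p \<in> bounded_partitions k" using bounded_partitions_mono[OF p \<open>m \<le> k\<close>] .
  then have pk': "p i \<le> k" for i
    using antimonoD[OF anti, of 0 i] by (simp add: bounded_partitions_def)
  obtain s where s: "packed k p s" using ex_packed[OF pk] ..
  note shift = packed_shift[OF s fin pk']
  let ?P = "col_height p (\<lambda>_. 0)"
  let ?r = "k - m + 1"
  obtain N where N: "\<And>i. N \<le> i \<Longrightarrow> p i = 0"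
    using finite_support_bound[OF fin] by metis
  have P_Suc: "?P i 0 = ?P (Suc i) 0 + (if 0 < p i then 1 else 0)" for i
    using col_height_Suc[OF fin, of "\<lambda>_. 0" i 0] by simp
  have height: "min (?r + 1) (?P i 0) \<le> col_height p s i 0" for i
  proof (induction "N - i" arbitrary: i)
    case 0
    then show ?case by (simp add: col_height_eq_0 N)
  next
    case (Suc d)
    then have IH: "min (?r + 1) (?P (Suc i) 0) \<le> col_height p s (Suc i) 0" by simp
    show ?case
    proof (cases "?P (Suc i) 0 \<le> ?r \<and> 0 < p i")
      case False
      have "col_height p s (Suc i) 0 \<le> col_height p s i 0"
        by (rule col_height_antimono_rows[OF fin]) simp
      then show ?thesis using IH P_Suc[of i] False by auto
    next
      case True
      have "p i < m"
      proof (rule ccontr)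
        \<comment> \<open>Otherwise all short rows would lie among the rows above row \<open>i\<close>, which are too few.\<close>
        assume "\<not> p i < m"
        then have "m \<le> p i'" if "i' \<le> i" for i'
          using antimonoD[OF anti that] by simp
        then have "short_rows m p \<subseteq> {i'. Suc i \<le> i' \<and> 0 \<le> (0::nat) \<and> 0 < 0 + p i'}"
          by (auto simp: short_rows_def) (meson leD not_less_eq_eq)
        then have "card (short_rows m p) \<le> ?P (Suc i) 0"
          unfolding col_height_def
          by (rule card_mono[OF finite_column[OF fin, of "Suc i" "\<lambda>_. 0" 0]])
        then show False using True short by linarith
      qed
      moreover have "col_height p s (Suc i) 0 \<le> ?P (Suc i) 0"
        by (rule col_height_le_length[OF fin])
      ultimately have "p i + col_height p s (Suc i) 0 \<le> k"
        using True \<open>m \<le> k\<close> by linarith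
      then have "s i = 0" using shift(2)[of 0 i] by linarith
      then show ?thesis
        using IH True P_Suc[of i] col_height_Suc[OF fin, of s i 0] by simp
    qed
  qed
  have "card (short_rows m p) \<le> ?P 0 0"
    unfolding col_height_def
    by (rule card_mono[OF finite_column[OF fin, of 0 "\<lambda>_. 0" 0]]) (auto simp: short_rows_def)
  then have "?r + 1 \<le> col_height p s 0 0" using height[of 0] short by simp
  then show ?thesis by (simp add: k_conjugate_packed[OF pk s])
qed

section \<open>Order ideals of rectangles\<close>

definition short_box :: "nat \<Rightarrow> nat \<Rightarrow> nat \<Rightarrow> (nat \<Rightarrow> nat) set" where
  "short_box m n r = {p. antimono p \<and> p \<le> rect m n \<and> card (short_rows m p) \<le> r}"

lemma le_rect_iff:
  "p \<le> rect m n \<longleftrightarrow> (\<forall>i. p i \<le> m) \<and> (\<forall>i\<ge>n. p i = 0)"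
proof
  assume p: "p \<le> rect m n"
  have "p i \<le> m \<and> (n \<le> i \<longrightarrow> p i = 0)" for i
    using le_funD[OF p, of i] by (simp add: rect_def split: if_splits)
  then show "(\<forall>i. p i \<le> m) \<and> (\<forall>i\<ge>n. p i = 0)"
    by blast
next
  assume "(\<forall>i. p i \<le> m) \<and> (\<forall>i\<ge>n. p i = 0)"
  then show "p \<le> rect m n" by (auto simp: le_fun_def rect_def)
qed

lemma bounded_if_le_rect:
  assumes "antimono p" and "p \<le> rect m n"
  shows "p \<in> bounded_partitions m"
proof -
  have "i < n" if "p i \<noteq> 0" for i using that assms(2) by (metis le_rect_iff not_le)
  then have "{i. p i \<noteq> 0} \<subseteq> {..<n}" by auto
  then have "finite {i. p i \<noteq> 0}" by (rule finite_subset) simp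
  then show ?thesis using assms by (simp add: bounded_partitions_def int_partition_def le_rect_iff)
qed

lemma psize_le_rect:
  assumes "p \<le> rect m n"
  shows "psize p = sum p {..<n}"
proof -
  have "i < n" if "p i \<noteq> 0" for i using that assms by (metis le_rect_iff not_le)
  then show ?thesis unfolding psize_def by (intro sum.mono_neutral_left) auto
qed

lemma rect_in_short_box: "rect m n \<in> short_box m n r"
proof -
  have "short_rows m (rect m n) = {}" by (auto simp: short_rows_def rect_def)
  then show ?thesis by (auto simp: short_box_def antimono_def rect_def)
qed

lemma weak_le_imp_le:
  assumes "weak_le k p q"
  shows "p \<le> q"
  using assms unfolding weak_le_def
proof (induction rule: rtranclp_induct)
  case (step q q')
  then have "q \<le> q'" by (simp add: weak_cover_def)
  then show ?case using step.IH by (rule order_trans[rotated])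
qed simp

text \<open>The first columns of the two \<open>k\<close>-skew diagrams suffice: that of \<open>q\<close> has at most \<open>k - m + 1\<close> cells,
  whereas too many short parts in \<open>p\<close> would give it a longer one.\<close>

lemma short_box_down_closed:
  assumes cover: "weak_cover k p q" and q: "q \<in> short_box m n (k - m + 1)"
    and m: "1 \<le> m" "m \<le> k"
  shows "p \<in> short_box m n (k - m + 1)"
proof -
  have "antimono p" and le: "p \<le> q" and conj: "k_conjugate k p 0 \<le> k_conjugate k q 0"
    using cover by (auto simp: weak_cover_def bounded_partitions_def int_partition_def le_fun_def)
  have "q \<le> rect m n" "antimono q" and short: "card (short_rows m q) \<le> k - m + 1"
    using q by (auto simp: short_box_def)
  then have "q \<in> bounded_partitions m" and pr: "p \<le> rect m n"
    using bounded_if_le_rect le order_trans by blast+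
  then have "k_conjugate k q 0 \<le> k - m + 1"
    using k_conjugate_few_short[OF _ m short, of 0] by simp
  moreover have "p \<in> bounded_partitions m"
    using bounded_if_le_rect[OF \<open>antimono p\<close> pr] .
  ultimately have "card (short_rows m p) \<le> k - m + 1"
    using k_conjugate_many_short[OF _ m(2), of p] conj by linarith
  then show ?thesis using \<open>antimono p\<close> pr by (simp add: short_box_def)
qed

text \<open>The cell is added in the lowest row \<open>i\<close> where \<open>p\<close> and \<open>q\<close> differ. This creates a new short row only if
  row \<open>i\<close> of \<open>p\<close> is empty. Then all rows of \<open>p\<close> are rows of \<open>q\<close>, so either row \<open>i\<close> of \<open>q\<close> is short and
  \<open>q\<close> has at least as many short rows as the new partition, or the rows below it are all full and the
  new partition has at most one short row.\<close>

lemma short_box_step: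
  assumes p: "p \<in> short_box m n r" and q: "q \<in> short_box m n r" and "p \<le> q" "p \<noteq> q" "1 \<le> r"
  obtains p' where "p' \<in> short_box m n r" "p \<le> p'" "p' \<le> q" "psize p' = psize p + 1"
proof -
  have "\<exists>i. p i \<noteq> q i" using \<open>p \<noteq> q\<close> by (simp add: fun_eq_iff)
  define i where "i = (LEAST i. p i \<noteq> q i)"
  have "p i \<noteq> q i" unfolding i_def using \<open>\<exists>i. p i \<noteq> q i\<close> by (rule LeastI_ex)
  then have pq: "p i < q i" using le_funD[OF \<open>p \<le> q\<close>, of i] by simp
  have eq: "p i' = q i'" if "i' < i" for i'
    using not_less_Least[OF that[unfolded i_def]] by simp
  have antip: "antimono p" and antiq: "antimono q" and pr: "p \<le> rect m n" and qr: "q \<le> rect m n"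
    and sp: "card (short_rows m p) \<le> r" and sq: "card (short_rows m q) \<le> r"
    using p q by (auto simp: short_box_def)
  let ?p = "p(i := p i + 1)"
  have le: "?p \<le> q" using pq \<open>p \<le> q\<close> by (auto simp: le_fun_def)
  then have pr': "?p \<le> rect m n" using qr by (rule order_trans)
  have "?p b \<le> ?p a" if "a \<le> b" for a b
  proof (cases "b = i \<and> a \<noteq> i")
    case True
    then have "p a = q a" "q i \<le> q a" using that eq antimonoD[OF antiq] by auto
    then show ?thesis using True pq by simp
  next
    case False
    then show ?thesis using antimonoD[OF antip that] by auto
  qed
  then have anti: "antimono ?p" by (simp add: antimono_def)
  have fin: "finite (short_rows m p)" "finite (short_rows m q)"
    using bounded_if_le_rect[OF antip pr] bounded_if_le_rect[OF antiq qr]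
    by (auto simp: bounded_partitions_def int_partition_def intro: finite_short_rows)
  have "card (short_rows m ?p) \<le> r"
  proof (cases "p i = 0")
    case False
    then have "short_rows m ?p \<subseteq> short_rows m p"
      by (auto simp: short_rows_def split: if_splits)
    then show ?thesis using le_trans[OF card_mono[OF fin(1)] sp] by blast
  next
    case True
    then have zero: "p b = 0" if "i \<le> b" for b using antimonoD[OF antip that] by simp
    show ?thesis
    proof (cases "q i < m")
      case True
      have "b \<in> short_rows m q" if "b \<in> short_rows m ?p" for b
      proof (cases b i rule: linorder_cases)
        case less
        then show ?thesis using that eq[of b] by (simp add: short_rows_def)
      next
        case equal
        then show ?thesis using True pq by (simp add: short_rows_def)
      next
        case greater
        then show ?thesis using that zero[of b] by (simp add: short_rows_def)
      qed
      then have "short_rows m ?p \<subseteq> short_rows m q" ..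
      then show ?thesis using le_trans[OF card_mono[OF fin(2)] sq] by blast
    next
      case False
      have "b = i" if "b \<in> short_rows m ?p" for b
      proof (cases b i rule: linorder_cases)
        case less
        then have "m \<le> p b" using antimonoD[OF antiq, of b i] eq[of b] False by simp
        then show ?thesis using that less by (simp add: short_rows_def)
      next
        case greater
        then show ?thesis using that zero[of b] by (simp add: short_rows_def)
      qed
      then have "short_rows m ?p \<subseteq> {i}" by blast
      then have "card (short_rows m ?p) \<le> card {i}" by (intro card_mono) simp_all
      then show ?thesis using \<open>1 \<le> r\<close> by simp
    qed
  qed
  then have "?p \<in> short_box m n r" using anti pr' by (simp add: short_box_def)
  moreover have "p \<le> ?p" by (simp add: le_fun_def)
  moreover have "psize ?p = psize p + 1"
  proof -
    have "i < n"
    proof (rule ccontr)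
      assume "\<not> i < n"
      then show False using qr pq by (simp add: le_rect_iff)
    qed
    then have "sum f {..<n} = f i + sum f ({..<n} - {i})" for f :: "nat \<Rightarrow> nat"
      by (intro sum.remove) simp_all
    moreover have "sum ?p ({..<n} - {i}) = sum p ({..<n} - {i})"
      by (rule sum.cong) auto
    ultimately show ?thesis
      unfolding psize_le_rect[OF pr'] psize_le_rect[OF pr] by simp
  qed
  ultimately show thesis using le by (intro that[of ?p])
qed

text \<open>Adding cells one at a time while keeping few short rows, every step is a cover, because the
  \<open>k\<close>-conjugate is monotone on partitions with few short rows.\<close>

lemma weak_le_if_le:
  assumes "p \<in> short_box m n (k - m + 1)" and q: "q \<in> short_box m n (k - m + 1)" and "p \<le> q"
    and m: "1 \<le> m" "m \<le> k"
  shows "weak_le k p q"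
  using assms(1,3)
proof (induction "psize q - psize p" arbitrary: p rule: less_induct)
  case less
  show ?case
  proof (cases "p = q")
    case True
    then show ?thesis by (simp add: weak_le_def)
  next
    case False
    obtain p' where p': "p' \<in> short_box m n (k - m + 1)" "p \<le> p'" "p' \<le> q" "psize p' = psize p + 1"
      using short_box_step[OF less.prems(1) q less.prems(2) False] by (metis le_add2)
    have bnd: "x \<in> bounded_partitions m" if "x \<in> short_box m n (k - m + 1)" for x
      using that bounded_if_le_rect by (auto simp: short_box_def)
    have "p' \<le> rect m n" "q \<le> rect m n" using p'(1) q by (simp_all add: short_box_def)
    then have "psize p' \<le> psize q"
      unfolding psize_le_rect[OF \<open>p' \<le> rect m n\<close>] psize_le_rect[OF \<open>q \<le> rect m n\<close>]
      by (intro sum_mono le_funD[OF p'(3)])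
    then have "psize q - psize p' < psize q - psize p" using p'(4) by simp
    then have "weak_le k p' q" using less.hyps p'(1,3) by blast
    moreover have "weak_cover k p p'"
      unfolding weak_cover_def
    proof (intro conjI)
      show "k_conjugate k p \<le> k_conjugate k p'"
        using less.prems(1) p' m bnd by (intro k_conjugate_mono) (auto simp: short_box_def)
    qed (use less.prems(1) p' m bnd bounded_partitions_mono in blast)+
    ultimately show ?thesis
      unfolding weak_le_def by (intro converse_rtranclp_into_rtranclp[of "weak_cover k" p p' q])
  qed
qed

lemma order_ideal_eq:
  assumes m: "1 \<le> m" "m \<le> k"
  shows "order_ideal k m n = short_box m n (k - m + 1)"
proof (intro set_eqI iffI)
  fix p assume "p \<in> order_ideal k m n"
  then have "(weak_cover k)\<^sup>*\<^sup>* p (rect m n)" by (simp add: order_ideal_def weak_le_def)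
  then show "p \<in> short_box m n (k - m + 1)"
  proof (induction rule: converse_rtranclp_induct)
    case base
    show ?case by (rule rect_in_short_box)
  next
    case (step p q)
    then show ?case using short_box_down_closed m by blast
  qed
next
  fix p assume p: "p \<in> short_box m n (k - m + 1)"
  then have "antimono p" "p \<le> rect m n" by (auto simp: short_box_def)
  then show "p \<in> order_ideal k m n"
    using weak_le_if_le[OF p rect_in_short_box _ m] bounded_if_le_rect bounded_partitions_mono[OF _ m(2)]
    by (simp add: order_ideal_def)
qed

section \<open>Duality by complementation in the rectangle\<close>

definition box_complement :: "nat \<Rightarrow> nat \<Rightarrow> (nat \<Rightarrow> nat) \<Rightarrow> (nat \<Rightarrow> nat)" where
  "box_complement m n p = (\<lambda>i. if i < n then m - p (n - 1 - i) else 0)"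

lemma box_complement_involution:
  assumes "p \<le> rect m n"
  shows "box_complement m n (box_complement m n p) = p"
  using assms by (auto simp: box_complement_def le_rect_iff)

lemma box_complement_antimono:
  assumes "p \<le> q"
  shows "box_complement m n q \<le> box_complement m n p"
  using assms by (auto simp: box_complement_def le_fun_def intro: diff_le_mono2)

lemma box_complement_in_short_box:
  assumes "p \<in> short_box m n r"
  shows "box_complement m n p \<in> short_box m n r"
proof -
  have anti: "antimono p" and pr: "p \<le> rect m n" and short: "card (short_rows m p) \<le> r"
    using assms by (auto simp: short_box_def)
  have "antimono (box_complement m n p)"
    using antimonoD[OF anti] by (auto simp: antimono_def box_complement_def intro!: diff_le_mono2)
  moreover have "box_complement m n p \<le> rect m n"
    by (auto simp: le_fun_def rect_def box_complement_def)
  moreover have "card (short_rows m (box_complement m n p)) \<le> card (short_rows m p)"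
  proof (rule card_inj_on_le)
    show "inj_on (\<lambda>i. n - 1 - i) (short_rows m (box_complement m n p))"
      by (auto simp: inj_on_def short_rows_def box_complement_def split: if_splits)
    show "(\<lambda>i. n - 1 - i) ` short_rows m (box_complement m n p) \<subseteq> short_rows m p"
      by (auto simp: short_rows_def box_complement_def split: if_splits)
    show "finite (short_rows m p)"
      using bounded_if_le_rect[OF anti pr]
      by (auto simp: bounded_partitions_def int_partition_def intro: finite_short_rows)
  qed
  ultimately show ?thesis using short by (simp add: short_box_def)
qed

theorem theorem37:
  fixes k m n :: nat
  assumes "1 \<le> m" and "1 \<le> n" and "m \<le> k"
  shows "self_dual (order_ideal k m n) (weak_le k)"
proof -
  let ?S = "short_box m n (k - m + 1)" and ?f = "box_complement m n"
  have inv: "?f (?f p) = p" if "p \<in> ?S" for p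
    using that box_complement_involution by (simp add: short_box_def)
  have le_iff: "weak_le k p q \<longleftrightarrow> p \<le> q" if "p \<in> ?S" "q \<in> ?S" for p q
    using that weak_le_imp_le weak_le_if_le assms(1,3) by blast
  have "bij_betw ?f ?S ?S"
    by (rule bij_betw_byWitness[where f' = ?f]) (use inv box_complement_in_short_box in auto)
  moreover have "weak_le k p q \<longleftrightarrow> weak_le k (?f q) (?f p)" if "p \<in> ?S" "q \<in> ?S" for p q
  proof -
    have "p \<le> q \<longleftrightarrow> ?f q \<le> ?f p"
      using box_complement_antimono inv that by metis
    then show ?thesis using that by (simp add: le_iff box_complement_in_short_box)
  qed
  ultimately show ?thesis
    unfolding self_dual_def order_isomorphic_def order_ideal_eq[OF assms(1,3)] by blast
qed

end
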